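(* Let $\Sigma$ be an alphabet with at least $3$ letters, say ${\tt 0}, {\tt 1}, {\tt 2} \in \Sigma$ distinct. Let $m, n, k$ be integers with $1 \leq m \leq n$ and $0 \leq k \leq m+n$. (a) If $m < n$, then there exist strings $x, y \in \Sigma^*$ with $|x| = m$, $|y| = n$ such that $h(xy,yx) = k$ if and only if $k \neq 1$. (b) If $m = n$, then there exist strings $x, y \in \Sigma^*$ with $|x| = m$, $|y| = n$ such that $h(xy,yx) = k$ if and only if $k$ is even. Furthermore, in both cases, whenever such strings exist, they can be chosen with $x = {\tt 0}^m$ (that is, there is $y \in \Sigma^*$ with $|y| = n$ and $h({\tt 0}^m y, y {\tt 0}^m) = k$).
   Context: $\Sigma^*$ is the set of finite strings over $\Sigma$; $|w|$ is the length of a string $w$; $xy$ denotes the concatenation of $x$ and $y$; ${\tt 0}^m$ is the string consisting of $m$ copies of the letter ${\tt 0}$. For strings $u, v$ of equal length, the Hamming distance $h(u,v)$ is the number of positions in which $u$ and $v$ differ. *)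

theory Defs
  imports Main
begin

text \<open>Only meant for strings of equal length.\<close>

definition hamming_distance :: "'a list \<Rightarrow> 'a list \<Rightarrow> nat" where
  "hamming_distance u v = card {i. i < length u \<and> u ! i \<noteq> v ! i}"

end

theory Submission
  imports Defs "HOL-Library.Multiset"
begin

text \<open>
  The strings \<open>x @ y\<close> and \<open>y @ x\<close> are rearrangements of each other, so they cannot differ in exactly
  one position; for \<open>m = n\<close> their distance is twice that of \<open>x\<close> and \<open>y\<close>. Conversely, for \<open>x = 0\<^sup>m\<close> one
  compares letters of \<open>y\<close>, padded by zeros, at distance \<open>m\<close>. Prefixing zeros to \<open>y\<close> does not change
  the distance, blocks of length \<open>m\<close> alternating between \<open>1\<close> and \<open>2\<close> realise the maximum \<open>m + n\<close>,
  \<open>1\<^sup>j 0\<^sup>m\<^sup>-\<^sup>j\<close> realises \<open>2j\<close>, and \<open>1\<^sup>j\<^sup>+\<^sup>1 0\<^sup>m\<^sup>-\<^sup>1\<^sup>-\<^sup>j 2\<close> realises \<open>2j + 3\<close>.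
\<close>

lemma hamming_distance_Nil [simp]: "hamming_distance [] v = 0"
  by (simp add: hamming_distance_def)

lemma hamming_distance_Cons [simp]:
  "hamming_distance (a # u) (b # v) = (if a = b then 0 else 1) + hamming_distance u v"
proof -
  have "{i. i < length (a # u) \<and> (a # u) ! i \<noteq> (b # v) ! i}
      = (if a = b then {} else {0}) \<union> Suc ` {i. i < length u \<and> u ! i \<noteq> v ! i}"
    (is "?L = ?R")
  proof (rule set_eqI)
    show "i \<in> ?L \<longleftrightarrow> i \<in> ?R" for i
      by (cases i) auto
  qed
  then show ?thesis
    by (simp add: hamming_distance_def card_image card_Un_disjoint)
qed

lemma hamming_distance_append:
  "length u = length v \<Longrightarrow>
    hamming_distance (u @ u') (v @ v') = hamming_distance u v + hamming_distance u' v'"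
  by (induction u v rule: list_induct2) auto

lemma hamming_distance_commute:
  "length u = length v \<Longrightarrow> hamming_distance u v = hamming_distance v u"
  by (induction u v rule: list_induct2) auto

lemma hamming_distance_eq_0_iff:
  "length u = length v \<Longrightarrow> hamming_distance u v = 0 \<longleftrightarrow> u = v"
  by (induction u v rule: list_induct2) auto

lemma hamming_distance_refl [simp]: "hamming_distance u u = 0"
  by (simp add: hamming_distance_eq_0_iff)

lemma hamming_distance_replicate:
  "a \<noteq> b \<Longrightarrow> hamming_distance (replicate j a) (replicate j b) = j"
  by (induction j) auto

text \<open>Equal heads cancel, leaving tails with equal multisets. If the heads differ, distance 1
  would force the tails to coincide, and then the multisets would differ in the heads.\<close>

lemma hamming_distance_mset_eq_neq_1:
  "length u = length v \<Longrightarrow> mset u = mset v \<Longrightarrow> hamming_distance u v \<noteq> 1"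
  by (induction u v rule: list_induct2) (auto simp: hamming_distance_eq_0_iff)

lemma hamming_distance_swap_neq_1: "hamming_distance (x @ y) (y @ x) \<noteq> 1"
  by (rule hamming_distance_mset_eq_neq_1) auto

lemma hamming_distance_swap_same_length:
  "length x = length y \<Longrightarrow> hamming_distance (x @ y) (y @ x) = 2 * hamming_distance x y"
  using hamming_distance_commute[of y x] by (simp add: hamming_distance_append)

text \<open>A power of \<open>a\<close> commutes with \<open>replicate m a\<close>, so both strings
  begin with \<open>replicate d a\<close>, and this common prefix cancels.\<close>

lemma hamming_distance_swap_replicate_prefix:
  "hamming_distance (replicate m a @ replicate d a @ y) ((replicate d a @ y) @ replicate m a)
    = hamming_distance (replicate m a @ y) (y @ replicate m a)"
proof -
  have "replicate m a @ replicate d a @ y = replicate d a @ replicate m a @ y"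
    by (metis add.commute append.assoc replicate_add)
  then show ?thesis
    by (simp only: append.assoc hamming_distance_append refl hamming_distance_refl add_0)
qed

text \<open>Indexing by \<open>i div m\<close> lets the last block be incomplete, so
  \<open>n\<close> need not be a multiple of \<open>m\<close>.\<close>

definition alternating_blocks :: "'a \<Rightarrow> 'a \<Rightarrow> nat \<Rightarrow> nat \<Rightarrow> 'a list" where
  "alternating_blocks b c m n = map (\<lambda>i. if even (i div m) then b else c) [0..<n]"

lemma hamming_distance_alternating_blocks:
  assumes "distinct [a, b, c]" "1 \<le> m" "m \<le> n"
  shows "hamming_distance (replicate m a @ alternating_blocks b c m n)
           (alternating_blocks b c m n @ replicate m a) = m + n"
proof -
  let ?y = "alternating_blocks b c m n"
  have "(replicate m a @ ?y) ! i \<noteq> (?y @ replicate m a) ! i" if "i < m + n" for i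
  \<comment> \<open>At either end exactly one of the two letters is the padding \<open>a\<close>,
    because \<open>m \<le> n\<close>. In between, \<open>?y ! (i - m)\<close> is compared with
    \<open>?y ! i\<close>, and these lie in consecutive blocks.\<close>
  proof (cases "i < m \<or> n \<le> i")
    case True
    then show ?thesis
      using assms that by (auto simp: alternating_blocks_def nth_append)
  next
    case False
    then have "i div m = Suc ((i - m) div m)"
      using assms by (simp add: le_div_geq)
    then show ?thesis
      using False assms by (auto simp: alternating_blocks_def nth_append)
  qed
  then have "{i. i < m + n \<and> (replicate m a @ ?y) ! i \<noteq> (?y @ replicate m a) ! i} = {..<m + n}"
    by auto
  then show ?thesis
    by (simp add: hamming_distance_def alternating_blocks_def)
qed

lemma hamming_distance_swap_even:
  fixes a b :: 'a and j d :: nat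
  assumes "a \<noteq> b"
  defines "y \<equiv> replicate j b @ replicate d a"
  shows "hamming_distance (replicate (j + d) a @ y) (y @ replicate (j + d) a) = 2 * j"
proof -
  have "hamming_distance (replicate (j + d) a) y = j"
    using assms by (simp add: replicate_add hamming_distance_append hamming_distance_replicate)
  then show ?thesis
    using hamming_distance_swap_same_length[of "replicate (j + d) a" y] by (simp add: y_def)
qed

text \<open>Here \<open>y\<close> is one letter longer than the power of \<open>a\<close>. Cut into
  aligned blocks of lengths \<open>Suc j\<close>, \<open>d\<close>, 1, \<open>j\<close>,
  \<open>d\<close>, 1, the two strings differ by \<open>Suc j\<close>, 0, 1, \<open>j\<close>, 0, 1.
  The third block compares \<open>b\<close> with \<open>c\<close>, which is where the third letter
  matters.\<close>

lemma hamming_distance_swap_odd: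
  fixes a b c :: 'a and j d :: nat
  assumes "distinct [a, b, c]"
  defines "y \<equiv> replicate (Suc j) b @ replicate d a @ [c]"
  shows "hamming_distance (replicate (Suc j + d) a @ y) (y @ replicate (Suc j + d) a) = 2 * j + 3"
proof -
  have "Suc j + d = j + (d + 1)"
    by simp
  then have "replicate (Suc j + d) a = replicate j a @ replicate d a @ [a]"
    by (simp only: replicate_add One_nat_def replicate.simps)
  then have "y @ replicate (Suc j + d) a
      = replicate (Suc j) b @ replicate d a @ [c] @ replicate j a @ replicate d a @ [a]"
    by (simp only: y_def append.assoc)
  moreover have "replicate (Suc j + d) a @ y
      = replicate (Suc j) a @ replicate d a @ [b] @ replicate j b @ replicate d a @ [c]"
    by (simp add: y_def replicate_add)
  ultimately have
    "hamming_distance (replicate (Suc j + d) a @ y) (y @ replicate (Suc j + d) a)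
      = hamming_distance
          (replicate (Suc j) a @ replicate d a @ [b] @ replicate j b @ replicate d a @ [c])
          (replicate (Suc j) b @ replicate d a @ [c] @ replicate j a @ replicate d a @ [a])"
    by (simp only:)
  also have "\<dots> = 2 * j + 3"
  proof -
    have "a \<noteq> b" "b \<noteq> a" "c \<noteq> a" "b \<noteq> c"
      using assms by auto
    then show ?thesis
      by (simp add: hamming_distance_append hamming_distance_replicate)
  qed
  finally show ?thesis .
qed

lemma hamming_distance_swap_realise:
  assumes "zero \<in> \<Sigma>" "one \<in> \<Sigma>" "two \<in> \<Sigma>" and dist: "distinct [zero, one, two]"
    and "1 \<le> m" "m \<le> n" "k \<le> m + n"
    and k: "if m < n then k \<noteq> 1 else even k"
  shows "\<exists>y \<in> lists \<Sigma>. length y = n \<and>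
           hamming_distance (replicate m zero @ y) (y @ replicate m zero) = k"
proof -
  \<comment> \<open>A shorter word suffices, since it can be padded with leading zeros.\<close>
  have "\<exists>w \<in> lists \<Sigma>. length w \<le> n \<and>
          hamming_distance (replicate m zero @ w) (w @ replicate m zero) = k"
  proof (cases "2 * m \<le> k")
    case True
    \<comment> \<open>The length is chosen so that the maximal distance \<open>m + (k - m)\<close>
      equals \<open>k\<close>; \<open>2 * m \<le> k\<close> gives \<open>m \<le> k - m\<close>, and
      \<open>k \<le> m + n\<close> gives \<open>k - m \<le> n\<close>.\<close>
    let ?w = "alternating_blocks one two m (k - m)"
    have "?w \<in> lists \<Sigma>" "length ?w \<le> n"
      using assms by (auto simp: alternating_blocks_def)
    moreover have "hamming_distance (replicate m zero @ ?w) (?w @ replicate m zero) = k"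
      using hamming_distance_alternating_blocks[OF dist \<open>1 \<le> m\<close>, of "k - m"] True by simp
    ultimately show ?thesis by blast
  next
    case False
    show ?thesis
    proof (cases "even k")
      case True
      define j where "j = k div 2"
      define d where "d = m - j"
      have eqs: "m = j + d" "k = 2 * j"
        using True False by (auto simp: j_def d_def)
      let ?w = "replicate j one @ replicate d zero"
      have "?w \<in> lists \<Sigma>" "length ?w \<le> n"
        using assms eqs by (auto simp: in_lists_conv_set)
      moreover have "hamming_distance (replicate m zero @ ?w) (?w @ replicate m zero) = k"
        using hamming_distance_swap_even[of zero one j d] dist unfolding eqs by simp
      ultimately show ?thesis by blast
    next
      case odd: False
      \<comment> \<open>An odd \<open>k\<close> is admissible only for \<open>m < n\<close>, which
        leaves room for a word of length \<open>m + 1\<close>. Being odd and not 1, \<open>k\<close>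
        is at least 3, and \<open>k < 2 * m\<close> yields \<open>Suc j \<le> m\<close>
        below.\<close>
      have "m < n" "k \<noteq> 1"
        using k odd by (auto split: if_splits)
      define j where "j = (k - 3) div 2"
      define d where "d = m - Suc j"
      have eqs: "m = Suc j + d" "k = 2 * j + 3"
        using odd False \<open>k \<noteq> 1\<close> unfolding j_def d_def by presburger+
      let ?w = "replicate (Suc j) one @ replicate d zero @ [two]"
      have "?w \<in> lists \<Sigma>" "length ?w \<le> n"
        using assms eqs \<open>m < n\<close> by (auto simp: in_lists_conv_set)
      moreover have "hamming_distance (replicate m zero @ ?w) (?w @ replicate m zero) = k"
        using hamming_distance_swap_odd[OF dist, of j d] unfolding eqs .
      ultimately show ?thesis by blast
    qed
  qed
  then obtain w where w: "w \<in> lists \<Sigma>" "length w \<le> n"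
    "hamming_distance (replicate m zero @ w) (w @ replicate m zero) = k"
    by blast
  let ?y = "replicate (n - length w) zero @ w"
  have "?y \<in> lists \<Sigma>" "length ?y = n"
    using w assms by (auto simp: in_lists_conv_set)
  moreover have "hamming_distance (replicate m zero @ ?y) (?y @ replicate m zero) = k"
    using w by (simp only: hamming_distance_swap_replicate_prefix)
  ultimately show ?thesis by blast
qed

theorem theorem1:
  fixes \<Sigma> :: "'a set" and zero one two :: 'a and m n k :: nat
  assumes "zero \<in> \<Sigma>" and "one \<in> \<Sigma>" and "two \<in> \<Sigma>"
    and "distinct [zero, one, two]"
    and "1 \<le> m" and "m \<le> n" and "k \<le> m + n"
  shows "(m < n \<longrightarrow>
           ((\<exists>x \<in> lists \<Sigma>. \<exists>y \<in> lists \<Sigma>. length x = m \<and> length y = n \<and>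
               hamming_distance (x @ y) (y @ x) = k) \<longleftrightarrow> k \<noteq> 1)) \<and>
         (m = n \<longrightarrow>
           ((\<exists>x \<in> lists \<Sigma>. \<exists>y \<in> lists \<Sigma>. length x = m \<and> length y = n \<and>
               hamming_distance (x @ y) (y @ x) = k) \<longleftrightarrow> even k)) \<and>
         ((\<exists>x \<in> lists \<Sigma>. \<exists>y \<in> lists \<Sigma>. length x = m \<and> length y = n \<and>
               hamming_distance (x @ y) (y @ x) = k) \<longrightarrow>
           (\<exists>y \<in> lists \<Sigma>. length y = n \<and>
               hamming_distance (replicate m zero @ y) (y @ replicate m zero) = k))"
proof -
  let ?achieved = "\<exists>x \<in> lists \<Sigma>. \<exists>y \<in> lists \<Sigma>. length x = m \<and> length y = n \<and>
    hamming_distance (x @ y) (y @ x) = k"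
  let ?achieved_by_zeros = "\<exists>y \<in> lists \<Sigma>. length y = n \<and>
    hamming_distance (replicate m zero @ y) (y @ replicate m zero) = k"
  let ?admissible = "if m < n then k \<noteq> 1 else even k"
  have nec: ?admissible if ?achieved
    using that \<open>m \<le> n\<close> hamming_distance_swap_neq_1
    by (auto simp: hamming_distance_swap_same_length)
  have suf: ?achieved_by_zeros if ?admissible
    by (rule hamming_distance_swap_realise[OF assms that])
  have wit: ?achieved if ?achieved_by_zeros
  proof -
    from that obtain y where "y \<in> lists \<Sigma>" "length y = n"
      "hamming_distance (replicate m zero @ y) (y @ replicate m zero) = k"
      by (elim bexE conjE)
    then show ?thesis
      using \<open>zero \<in> \<Sigma>\<close> by (intro bexI[of _ "replicate m zero"] bexI[of _ y]) auto
  qed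
  \<comment> \<open>The implications form a cycle: achieved, admissible, achieved by zeros,
    achieved.\<close>
  have iff: "?achieved \<longleftrightarrow> ?admissible"
    using nec wit[OF suf] by (rule iffI)
  show ?thesis
    unfolding iff using suf by simp
qed

end
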